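(* Let $X$ be a CAT(0) space and let $\gamma:[0,\infty)\to X$ be a curve parametrized by arclength $t$. Let $\tau(t)$ be its total curvature function and $c(t)$ its circumradius function. Then: (a) If $\liminf_{t\to\infty}\tau(t)/t=0$, then $\gamma$ is unbounded. (b) If $\tau\in O(t^{a})$ for some $a\in(0,1)$, then $c\in\Omega(t^{1-a})$.
   Context: A CAT(0) space is a geodesic metric space in which the distance between any two points of any geodesic triangle is at most the distance between the corresponding points of the triangle with the same sidelengths in the Euclidean plane. The angle in $[0,\pi]$ between two geodesic segments from a common point is the limit (= infimum) of the corresponding angles in Euclidean model triangles for initial subsegments. Total curvature: a polygonal curve is a piecewise-geodesic curve. The total rotation of a polygonal curve $\sigma$ is $\tau_\sigma=\sum_i(\pi-\beta_i)$, where the $\beta_i$ are the angles at its interior vertices. The total curvature $\tau_\gamma\in[0,\infty]$ of a curve $\gamma$ is the $\limsup$ of $\tau_\sigma$ as $\mu_\sigma\to0$, over all polygonal curves $\sigma$ inscribed in $\gamma$, where $\mu_\sigma$ is the maximum segment length of $\sigma$. (In a CAT(0) space this equals the supremum of $\tau_\sigma$ over all inscribed polygonal $\sigma$.) The total curvature function is $\tau(t)=\tau_{\gamma|_{[0,t]}}$. The circumradius function is $c(t)$ = the smallest number such that $\gamma|_{[0,t]}$ lies in the (closed) ball of radius $c(t)$ about $\gamma(0)$. $O$ and $\Omega$ are as $t\to\infty$: $f\in O(g)$ means $f(t)\le Cg(t)$, and $f\in\Omega(g)$ means $f(t)\ge Cg(t)$, for some constant $C>0$ and all sufficiently large $t$.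 *)

theory Defs
  imports "HOL-Analysis.Analysis" "HOL-Library.Landau_Symbols"
begin

definition geodesic :: "(real \<Rightarrow> 'a::metric_space) \<Rightarrow> 'a \<Rightarrow> 'a \<Rightarrow> bool" where
  "geodesic c x y \<longleftrightarrow> c 0 = x \<and> c (dist x y) = y \<and>
     (\<forall>s\<in>{0..dist x y}. \<forall>t\<in>{0..dist x y}. dist (c s) (c t) = \<bar>s - t\<bar>)"

text \<open>The points of the side \<open>c\<close> from \<open>x\<close> to \<open>y\<close>, each paired with its corresponding point
  on the side from \<open>x'\<close> to \<open>y'\<close> of a model triangle in the Euclidean plane.\<close>

definition side_pairs ::
  "(real \<Rightarrow> 'a::metric_space) \<Rightarrow> 'a \<Rightarrow> 'a \<Rightarrow> real^2 \<Rightarrow> real^2 \<Rightarrow> ('a \<times> (real^2)) set" where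
  "side_pairs c x y x' y' =
     {(c s, z') | s z'. s \<in> {0..dist x y} \<and> z' \<in> closed_segment x' y' \<and> dist x' z' = s}"

definition CAT0 :: "'a::metric_space itself \<Rightarrow> bool" where
  "CAT0 _ \<longleftrightarrow>
     (\<forall>x y :: 'a. \<exists>c. geodesic c x y) \<and>
     (\<forall>(p::'a) q r c1 c2 c3 p' q' r'.
        geodesic c1 p q \<longrightarrow> geodesic c2 q r \<longrightarrow> geodesic c3 r p \<longrightarrow>
        dist p' q' = dist p q \<longrightarrow> dist q' r' = dist q r \<longrightarrow> dist r' p' = dist r p \<longrightarrow>
        (let T = side_pairs c1 p q p' q' \<union> side_pairs c2 q r q' r' \<union> side_pairs c3 r p r' p'
         in \<forall>(x, x')\<in>T. \<forall>(y, y')\<in>T. dist x y \<le> dist x' y'))"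

text \<open>The angle at the vertex of \<open>p\<close> in the Euclidean model triangle of \<open>p, x, y\<close>, by the law of
  cosines; only meaningful if \<open>x \<noteq> p\<close> and \<open>y \<noteq> p\<close>.\<close>

definition model_angle :: "'a::metric_space \<Rightarrow> 'a \<Rightarrow> 'a \<Rightarrow> real" where
  "model_angle p x y =
     arccos (((dist p x)\<^sup>2 + (dist p y)\<^sup>2 - (dist x y)\<^sup>2) / (2 * dist p x * dist p y))"

lemma model_angle_eq:
  fixes p x y :: "'a::metric_space" and p' x' y' :: "real^2"
  assumes "dist p' x' = dist p x" "dist p' y' = dist p y" "dist x' y' = dist x y"
  shows "model_angle p x y =
           arccos (((x' - p') \<bullet> (y' - p')) / (norm (x' - p') * norm (y' - p')))"
proof -
  have "(norm ((x' - p') - (y' - p')))\<^sup>2 =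
          (norm (x' - p'))\<^sup>2 + (norm (y' - p'))\<^sup>2 - 2 * ((x' - p') \<bullet> (y' - p'))"
    by (simp add: power2_norm_eq_inner inner_diff inner_commute)
  then show ?thesis
    using assms by (simp add: model_angle_def dist_norm norm_minus_commute)
qed

text \<open>The angle between two geodesics issuing from the same point \<open>c 0 = d 0\<close>.\<close>

definition angle :: "(real \<Rightarrow> 'a::metric_space) \<Rightarrow> (real \<Rightarrow> 'a) \<Rightarrow> real" where
  "angle c d = Lim (at_right 0 \<times>\<^sub>F at_right 0) (\<lambda>(s, t). model_angle (c 0) (c s) (d t))"

text \<open>A polygonal curve is given by its list \<open>vs\<close> of vertices together with geodesics \<open>g i\<close> from
  \<open>vs ! i\<close> to \<open>vs ! Suc i\<close>. Consecutive vertices are required to be distinct, since no angle is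
  defined at the end of a degenerate segment.\<close>

definition polygonal :: "'a::metric_space list \<Rightarrow> (nat \<Rightarrow> real \<Rightarrow> 'a) \<Rightarrow> bool" where
  "polygonal vs g \<longleftrightarrow> vs \<noteq> [] \<and>
     (\<forall>i. Suc i < length vs \<longrightarrow> vs ! i \<noteq> vs ! Suc i \<and> geodesic (g i) (vs ! i) (vs ! Suc i))"

definition mesh :: "'a::metric_space list \<Rightarrow> real" where
  "mesh vs = Max (insert 0 {dist (vs ! i) (vs ! Suc i) | i. Suc i < length vs})"

text \<open>At an interior vertex, the incoming geodesic has to be reversed.\<close>

definition total_rotation :: "'a::metric_space list \<Rightarrow> (nat \<Rightarrow> real \<Rightarrow> 'a) \<Rightarrow> real" where
  "total_rotation vs g =
     (\<Sum>i\<in>{0<..<length vs - 1}.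
        pi - angle (\<lambda>s. g (i - 1) (dist (vs ! (i - 1)) (vs ! i) - s)) (g i))"

definition partitions :: "real \<Rightarrow> real \<Rightarrow> real list set" where
  "partitions a b = {ts. ts \<noteq> [] \<and> sorted_wrt (<) ts \<and> hd ts = a \<and> last ts = b}"

definition inscribed ::
  "(real \<Rightarrow> 'a::metric_space) \<Rightarrow> real \<Rightarrow> real \<Rightarrow> ('a list \<times> (nat \<Rightarrow> real \<Rightarrow> 'a)) set" where
  "inscribed \<gamma> a b = {(map \<gamma> ts, g) | ts g. ts \<in> partitions a b \<and> polygonal (map \<gamma> ts) g}"

text \<open>The limes superior of the total rotation over the inscribed polygonal curves as the mesh
  tends to \<open>0\<close>.\<close>

definition total_curvature :: "(real \<Rightarrow> 'a::metric_space) \<Rightarrow> real \<Rightarrow> real \<Rightarrow> ennreal" where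
  "total_curvature \<gamma> a b =
     (INF \<delta>\<in>{0<..}. SUP (vs, g)\<in>{(vs, g) \<in> inscribed \<gamma> a b. mesh vs < \<delta>}.
        ennreal (total_rotation vs g))"

definition curve_length :: "(real \<Rightarrow> 'a::metric_space) \<Rightarrow> real \<Rightarrow> real \<Rightarrow> ennreal" where
  "curve_length \<gamma> a b =
     (SUP ts\<in>partitions a b. \<Sum>i<length ts - 1. ennreal (dist (\<gamma> (ts ! i)) (\<gamma> (ts ! Suc i))))"

definition arclength_parametrized :: "(real \<Rightarrow> 'a::metric_space) \<Rightarrow> bool" where
  "arclength_parametrized \<gamma> \<longleftrightarrow>
     continuous_on {0..} \<gamma> \<and> (\<forall>a b. 0 \<le> a \<longrightarrow> a \<le> b \<longrightarrow> curve_length \<gamma> a b = ennreal (b - a))"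

definition circumradius :: "(real \<Rightarrow> 'a::metric_space) \<Rightarrow> real \<Rightarrow> real" where
  "circumradius \<gamma> t = (LEAST r. \<gamma> ` {0..t} \<subseteq> cball (\<gamma> 0) r)"

end

theory Submission
  imports Defs
begin

text \<open>Both parts follow from one inequality: if \<open>\<gamma>\<close> restricted to \<open>[0, t]\<close> stays within distance
  \<open>r\<close> of \<open>\<gamma> 0\<close>, then \<open>t \<le> r * (\<tau>(t) + 1)\<close>, which is
  \<open>arclength_le_radius_times_curvature\<close>. For bounded \<open>\<gamma>\<close> it forces \<open>\<tau>(t) / t\<close> to stay above a
  positive constant for large \<open>t\<close>, and with \<open>r = c(t)\<close> and \<open>\<tau>(t) \<le> C t\<^sup>a\<close> it gives
  \<open>t \<le> c(t) (C + 1) t\<^sup>a\<close> for \<open>t \<ge> 1\<close>.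

  In Euclidean space the inequality comes from integrating \<open>\<langle>\<gamma>', \<gamma>'\<rangle>\<close> by parts. The discrete version
  for a polygon and an apex \<open>p\<close> replaces the integration by parts by the following. In the Euclidean
  model of the triangle with apex \<open>p\<close> over a segment, the foot of the altitude from \<open>p\<close> divides the
  segment into two signed pieces, one for each endpoint. Summing and regrouping the pieces by
  vertices, each interior vertex \<open>v\<close> receives two pieces, and the nonpositive curvature bounds their
  sum by \<open>dist p v\<close> times the rotation at \<open>v\<close> (\<open>CAT0_feet_le_turning\<close>). Indeed, let \<open>m\<close> be the
  midpoint of the two points at distance \<open>s\<close> from \<open>v\<close> on the sides at \<open>v\<close>, and \<open>\<theta>\<close> the model angle
  there. Then \<open>dist v m \<le> s cos (\<theta> / 2)\<close>, so \<open>p\<close> is no closer to \<open>m\<close> than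
  \<open>dist p v - s cos (\<theta> / 2)\<close>, whereas large pieces would bring both points, and by convexity also
  \<open>m\<close>, too close to \<open>p\<close>. This gives \<open>2 dist p v cos (\<theta> / 2)\<close> as a bound for the sum, and
  \<open>2 cos (\<theta> / 2) \<le> pi - \<theta>\<close>.

  For every \<open>\<delta>\<close> there are inscribed polygons of mesh below \<open>\<delta>\<close> and length arbitrarily close to
  \<open>t\<close> (\<open>inscribed_polygon_exists\<close>), so the inequality passes to the limes superior.\<close>

section \<open>Comparison of distances\<close>

lemma geodesicD:
  assumes "geodesic c x y"
  shows geodesic_start: "c 0 = x"
    and geodesic_dist: "\<lbrakk>0 \<le> s; s \<le> dist x y; 0 \<le> t; t \<le> dist x y\<rbrakk> \<Longrightarrow> dist (c s) (c t) = \<bar>s - t\<bar>"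
  using assms by (auto simp: geodesic_def)

lemma dist_geodesic_start:
  assumes "geodesic c x y" "0 \<le> s" "s \<le> dist x y"
  shows "dist x (c s) = s"
  using geodesic_dist[OF assms(1), of 0 s] geodesic_start[OF assms(1)] assms by simp

lemma geodesic_initial:
  assumes "geodesic c x y" "0 \<le> s" "s \<le> dist x y"
  shows "geodesic c x (c s)"
  using assms dist_geodesic_start[OF assms] by (auto simp: geodesic_def)

lemma geodesic_reverse:
  assumes "geodesic c x y"
  shows "geodesic (\<lambda>s. c (dist x y - s)) y x"
  using assms by (auto simp: geodesic_def dist_commute)

lemma model_triangle_exists:
  fixes p v w :: "'a::metric_space"
  assumes "v \<noteq> w"
  obtains p' v' w' :: "real^2"
  where "dist p' v' = dist p v" "dist v' w' = dist v w" "dist w' p' = dist w p"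
proof -
  define l a b where "l = dist v w" and "a = dist p v" and "b = dist w p"
  define x where "x = (a\<^sup>2 + l\<^sup>2 - b\<^sup>2) / (2 * l)"
  have l: "l > 0" and nn: "a \<ge> 0" "b \<ge> 0"
    using assms by (auto simp: l_def a_def b_def)
  have tri: "b \<le> a + l" "l \<le> a + b" "a \<le> b + l"
    unfolding l_def a_def b_def by metric+
  have b2: "b\<^sup>2 \<le> (a + l)\<^sup>2" using tri nn by (intro power_mono) auto
  have al2: "(a - l)\<^sup>2 \<le> b\<^sup>2" using tri nn by (intro abs_le_square_iff[THEN iffD1]) auto
  have "x \<le> a" "- a \<le> x"
    using l b2 al2 by (auto simp: x_def field_simps power2_eq_square)
  then have "\<bar>x\<bar> \<le> \<bar>a\<bar>" by linarith
  then have h: "(sqrt (a\<^sup>2 - x\<^sup>2))\<^sup>2 = a\<^sup>2 - x\<^sup>2"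
    using abs_le_square_iff by (intro real_sqrt_pow2) auto
  have "(l - x)\<^sup>2 + (a\<^sup>2 - x\<^sup>2) = b\<^sup>2"
    using l by (simp add: x_def field_simps power2_eq_square)
  then have "sqrt ((l - x)\<^sup>2 + (a\<^sup>2 - x\<^sup>2)) = b" using nn by simp
  then show thesis
    using l nn h that[of "vector [x, sqrt (a\<^sup>2 - x\<^sup>2)]" "0" "vector [l, 0]"]
    by (simp add: dist_vec_def L2_set_def sum_2 dist_real_def a_def b_def l_def)
qed

lemma CAT0_geodesic_exists:
  fixes x y :: "'a::metric_space"
  assumes "CAT0 TYPE('a)"
  obtains c where "geodesic c x y"
  using assms unfolding CAT0_def by blast

text \<open>The right-hand side is \<open>dist v w\<close> times the squared distance from the apex to the corresponding
  point of the model triangle, by Stewart's theorem. In this form, free of model triangles,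
  nonpositive curvature enters all later arguments.\<close>

lemma CAT0_stewart:
  fixes p v w :: "'a::metric_space"
  assumes cat: "CAT0 TYPE('a)" and c: "geodesic c v w" and s: "0 \<le> s" "s \<le> dist v w"
  shows "dist v w * (dist p (c s))\<^sup>2
           \<le> (dist v w - s) * (dist p v)\<^sup>2 + s * (dist p w)\<^sup>2 - s * (dist v w - s) * dist v w"
proof (cases "v = w")
  case True
  then show ?thesis using s by simp
next
  case False
  define l where "l = dist v w"
  have l: "l > 0" using False by (simp add: l_def)
  obtain p' v' w' :: "real^2" where m:
    "dist p' v' = dist p v" "dist v' w' = dist v w" "dist w' p' = dist w p"
    using model_triangle_exists[OF False] by blast
  obtain c1 where c1: "geodesic c1 p v" using CAT0_geodesic_exists[OF cat] .
  obtain c3 where c3: "geodesic c3 w p" using CAT0_geodesic_exists[OF cat] .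
  define z where "z = v' + (s / l) *\<^sub>R (w' - v')"
  have z_seg: "z \<in> closed_segment v' w'"
    unfolding in_segment z_def using s l
    by (intro exI[of _ "s / l"]) (auto simp: l_def algebra_simps)
  have "dist v' z = s / l * norm (w' - v')"
    using s l by (simp add: z_def dist_norm)
  then have vz: "dist v' z = s"
    using m(2) l by (simp add: l_def dist_norm norm_minus_commute)
  have in1: "(p, p') \<in> side_pairs c1 p v p' v'"
    unfolding side_pairs_def using geodesic_start[OF c1]
    by (auto intro!: exI[of _ "0::real"] exI[of _ p'])
  have in2: "(c s, z) \<in> side_pairs c v w v' w'"
    unfolding side_pairs_def using z_seg vz s by auto
  have "\<forall>(x, x')\<in>side_pairs c1 p v p' v' \<union> side_pairs c v w v' w' \<union> side_pairs c3 w p w' p'.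
        \<forall>(y, y')\<in>side_pairs c1 p v p' v' \<union> side_pairs c v w v' w' \<union> side_pairs c3 w p w' p'.
          dist x y \<le> dist x' y'"
    using cat c1 c c3 m unfolding CAT0_def Let_def by blast
  then have "dist p (c s) \<le> dist p' z" using in1 in2 by fast
  then have le: "l * (dist p (c s))\<^sup>2 \<le> l * (dist p' z)\<^sup>2"
    using l by (intro mult_left_mono power_mono) auto
  define f e where "f = v' - p'" and "e = w' - v'"
  have fn: "(dist p v)\<^sup>2 = f \<bullet> f" and en: "l\<^sup>2 = e \<bullet> e"
    using m by (simp_all add: f_def e_def l_def dist_norm norm_minus_commute flip: power2_norm_eq_inner)
  have "dist p w = norm (f + e)"
    using m by (simp add: f_def e_def dist_norm norm_minus_commute dist_commute[of p w])
  then have fen: "(dist p w)\<^sup>2 = f \<bullet> f + 2 * (f \<bullet> e) + l\<^sup>2"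
    unfolding en by (simp add: power2_norm_eq_inner inner_add inner_commute)
  have "dist p' z = norm (f + (s / l) *\<^sub>R e)"
    by (simp add: f_def e_def z_def dist_norm norm_minus_commute algebra_simps)
  then have "(dist p' z)\<^sup>2 = f \<bullet> f + 2 * (s / l) * (f \<bullet> e) + (s / l)\<^sup>2 * l\<^sup>2"
    unfolding en power2_norm_eq_inner[symmetric, of "f + _"]
    by (simp add: power2_norm_eq_inner inner_add inner_commute power_divide)
      (simp add: power2_eq_square)
  then have "l * (dist p' z)\<^sup>2
      = (l - s) * (dist p v)\<^sup>2 + s * (dist p w)\<^sup>2 - s * (l - s) * l"
    unfolding fen fn using l by (simp add: field_simps power2_eq_square)
  then show ?thesis using le by (simp add: l_def)
qed

text \<open>The inequality of Bruhat and Tits.\<close>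

lemma CAT0_midpoint:
  fixes x y :: "'a::metric_space"
  assumes "CAT0 TYPE('a)"
  obtains m where "\<And>p. (dist p m)\<^sup>2 \<le> ((dist p x)\<^sup>2 + (dist p y)\<^sup>2) / 2 - (dist x y)\<^sup>2 / 4"
proof -
  obtain h where h: "geodesic h x y" using CAT0_geodesic_exists[OF assms] .
  show thesis
  proof (cases "x = y")
    case True
    then show thesis using that[of x] by simp
  next
    case False
    have "(dist p (h (dist x y / 2)))\<^sup>2
        \<le> ((dist p x)\<^sup>2 + (dist p y)\<^sup>2) / 2 - (dist x y)\<^sup>2 / 4" for p
    proof -
      have "dist x y * (dist p (h (dist x y / 2)))\<^sup>2
          \<le> dist x y * (((dist p x)\<^sup>2 + (dist p y)\<^sup>2) / 2 - (dist x y)\<^sup>2 / 4)"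
        using CAT0_stewart[OF assms h, of "dist x y / 2" p]
        by (simp add: field_simps power2_eq_square)
      then show ?thesis using False by simp
    qed
    then show thesis using that by blast
  qed
qed

section \<open>Angles\<close>

lemma model_angle_commute: "model_angle p x y = model_angle p y x"
  by (simp add: model_angle_def dist_commute ac_simps)

lemma model_cos_bounds:
  fixes p x y :: "'a::metric_space"
  assumes "x \<noteq> p" "y \<noteq> p"
  shows "\<bar>((dist p x)\<^sup>2 + (dist p y)\<^sup>2 - (dist x y)\<^sup>2) / (2 * dist p x * dist p y)\<bar> \<le> 1"
proof -
  define a b k where "a = dist p x" and "b = dist p y" and "k = dist x y"
  have pos: "a > 0" "b > 0" "k \<ge> 0" using assms by (auto simp: a_def b_def k_def)
  have "k \<le> a + b" "\<bar>a - b\<bar> \<le> \<bar>k\<bar>" unfolding a_def b_def k_def by metric+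
  then have "k\<^sup>2 \<le> (a + b)\<^sup>2" "(a - b)\<^sup>2 \<le> k\<^sup>2"
    using pos by (auto intro: power_mono simp flip: abs_le_square_iff)
  then have "\<bar>a\<^sup>2 + b\<^sup>2 - k\<^sup>2\<bar> \<le> 2 * a * b" by (auto simp: power2_eq_square algebra_simps abs_le_iff)
  then show ?thesis using pos by (simp add: a_def b_def k_def abs_mult)
qed

lemma model_angle_bounds:
  fixes p x y :: "'a::metric_space"
  assumes "x \<noteq> p" "y \<noteq> p"
  shows "0 \<le> model_angle p x y" "model_angle p x y \<le> pi"
  using model_cos_bounds[OF assms, THEN abs_le_D1] model_cos_bounds[OF assms, THEN abs_le_D2]
  unfolding model_angle_def by (intro arccos_lbound arccos_ubound; linarith)+

text \<open>The Stewart bound for the triangle \<open>v\<close>, \<open>c s\<close>, \<open>y\<close> at the point \<open>c s'\<close> says exactly that the cosine of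
  the model angle at \<open>v\<close> does not decrease when \<open>c s\<close> is replaced by \<open>c s'\<close>.\<close>

lemma model_angle_mono_left:
  fixes v w y :: "'a::metric_space"
  assumes cat: "CAT0 TYPE('a)" and c: "geodesic c v w"
    and s: "0 < s'" "s' \<le> s" "s \<le> dist v w" and y: "y \<noteq> v"
  shows "model_angle v (c s') y \<le> model_angle v (c s) y"
proof -
  define t k k' where "t = dist v y" and "k = dist (c s) y" and "k' = dist (c s') y"
  have t: "t > 0" using y by (simp add: t_def)
  have d: "dist v (c s) = s" "dist v (c s') = s'"
    using dist_geodesic_start[OF c] s by auto
  have ne: "c s \<noteq> v" "c s' \<noteq> v" using d s by auto
  have "s * k'\<^sup>2 \<le> (s - s') * t\<^sup>2 + s' * k\<^sup>2 - s' * (s - s') * s"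
    using CAT0_stewart[OF cat geodesic_initial[OF c, of s], of s' y] s d
    by (simp add: t_def k_def k'_def dist_commute)
  then have "(s\<^sup>2 + t\<^sup>2 - k\<^sup>2) * s' \<le> (s'\<^sup>2 + t\<^sup>2 - k'\<^sup>2) * s"
    by (simp add: algebra_simps power2_eq_square)
  then have "((s\<^sup>2 + t\<^sup>2 - k\<^sup>2) * s') / (2 * s * s' * t) \<le> ((s'\<^sup>2 + t\<^sup>2 - k'\<^sup>2) * s) / (2 * s * s' * t)"
    using s t by (intro divide_right_mono) auto
  then have "(s\<^sup>2 + t\<^sup>2 - k\<^sup>2) / (2 * s * t) \<le> (s'\<^sup>2 + t\<^sup>2 - k'\<^sup>2) / (2 * s' * t)"
    using s t by simp
  then show ?thesis
    using model_cos_bounds[OF ne(1) y] model_cos_bounds[OF ne(2) y]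
    unfolding model_angle_def d t_def[symmetric] k_def[symmetric] k'_def[symmetric]
    by (simp add: arccos_le_mono)
qed

text \<open>Since the model angle is monotone in both parameters, it converges to its infimum as they tend
  to \<open>0\<close>. So the limit that defines the angle exists, and the angle is that infimum.\<close>

lemma CAT0_angle_le_model_angle:
  fixes v u w :: "'a::metric_space"
  assumes cat: "CAT0 TYPE('a)" and c: "geodesic c v u" and e: "geodesic e v w"
    and s: "0 < s" "s \<le> dist v u" and t: "0 < t" "t \<le> dist v w"
  shows "0 \<le> angle c e" "angle c e \<le> model_angle v (c s) (e t)"
proof -
  define F where "F = (\<lambda>(s, t). model_angle v (c s) (e t))"
  define I where "I = {0<..dist v u} \<times> {0<..dist v w}"
  define L where "L = Inf (F ` I)"
  have c0: "c s \<noteq> v" if "0 < s" "s \<le> dist v u" for s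
    using dist_geodesic_start[OF c, of s] that by auto
  have e0: "e t \<noteq> v" if "0 < t" "t \<le> dist v w" for t
    using dist_geodesic_start[OF e, of t] that by auto
  have nonneg: "0 \<le> F q" if "q \<in> I" for q
    using that c0 e0 unfolding F_def I_def
    by (auto intro: model_angle_bounds(1)[OF c0 e0])
  have bdd: "bdd_below (F ` I)" using nonneg by (auto intro!: bdd_belowI)
  have st: "(s, t) \<in> I" using s t by (simp add: I_def)
  have mono: "F (s', t') \<le> F (s, t)"
    if "(s, t) \<in> I" "0 < s'" "s' \<le> s" "0 < t'" "t' \<le> t" for s t s' t'
  proof -
    have "F (s', t') \<le> F (s, t')"
      unfolding F_def using that e0[of t'] by (auto simp: I_def intro!: model_angle_mono_left[OF cat c])
    also have "\<dots> \<le> F (s, t)"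
      unfolding F_def using that c0[of s]
      by (auto simp: I_def model_angle_commute[of v "c s"] intro!: model_angle_mono_left[OF cat e])
    finally show ?thesis .
  qed
  have L_le: "L \<le> F q" if "q \<in> I" for q
    unfolding L_def using that bdd by (intro cInf_lower) auto
  have "(F \<longlongrightarrow> L) (at_right 0 \<times>\<^sub>F at_right 0)"
  proof (rule order_tendstoI)
    fix a assume "a < L"
    have "eventually (\<lambda>s. 0 < s \<and> s \<le> dist v u) (at_right 0)"
      using s by (intro eventually_at_rightI[of 0 "dist v u"]) auto
    moreover have "eventually (\<lambda>t. 0 < t \<and> t \<le> dist v w) (at_right 0)"
      using t by (intro eventually_at_rightI[of 0 "dist v w"]) auto
    ultimately have "eventually (\<lambda>q. (0 < fst q \<and> fst q \<le> dist v u) \<and> (0 < snd q \<and> snd q \<le> dist v w))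
        (at_right 0 \<times>\<^sub>F at_right 0)"
      by (rule eventually_prodI)
    then show "eventually (\<lambda>q. a < F q) (at_right 0 \<times>\<^sub>F at_right 0)"
      by (rule eventually_mono) (use L_le \<open>a < L\<close> in \<open>force simp: I_def\<close>)
  next
    fix a assume "L < a"
    then obtain s1 t1 where q: "(s1, t1) \<in> I" "F (s1, t1) < a"
      unfolding L_def using cInf_lessD[of "F ` I" a] st by fastforce
    have "eventually (\<lambda>s. 0 < s \<and> s \<le> s1) (at_right 0)"
      using q by (intro eventually_at_rightI[of 0 s1]) (auto simp: I_def)
    moreover have "eventually (\<lambda>t. 0 < t \<and> t \<le> t1) (at_right 0)"
      using q by (intro eventually_at_rightI[of 0 t1]) (auto simp: I_def)
    ultimately have "eventually (\<lambda>q. (0 < fst q \<and> fst q \<le> s1) \<and> (0 < snd q \<and> snd q \<le> t1))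
        (at_right 0 \<times>\<^sub>F at_right 0)"
      by (rule eventually_prodI)
    then show "eventually (\<lambda>q. F q < a) (at_right 0 \<times>\<^sub>F at_right 0)"
      by (rule eventually_mono) (use mono[OF q(1)] q(2) in force)
  qed
  then have "Lim (at_right 0 \<times>\<^sub>F at_right 0) F = L"
    by (intro tendsto_Lim) (auto simp: prod_filter_eq_bot)
  then have "angle c e = L"
    by (simp add: angle_def F_def geodesic_start[OF c])
  moreover have "0 \<le> L"
    unfolding L_def using st nonneg by (intro cInf_greatest) auto
  ultimately show "0 \<le> angle c e" "angle c e \<le> model_angle v (c s) (e t)"
    using L_le[OF st] by (auto simp: F_def)
qed

section \<open>The length of a polygon in a ball\<close>

text \<open>The signed distance from \<open>v\<close> to the foot of the altitude from \<open>p\<close> in the model triangle of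
  \<open>p, v, w\<close>, positive towards \<open>w\<close>. It equals \<open>dist p v\<close> times the cosine of the model angle at \<open>v\<close>, but
  remains meaningful for \<open>p = v\<close>.\<close>

definition foot :: "'a::metric_space \<Rightarrow> 'a \<Rightarrow> 'a \<Rightarrow> real" where
  "foot p v w = ((dist p v)\<^sup>2 + (dist v w)\<^sup>2 - (dist p w)\<^sup>2) / (2 * dist v w)"

lemma foot_add_foot:
  assumes "v \<noteq> w"
  shows "foot p v w + foot p w v = dist v w"
  using assms by (simp add: foot_def dist_commute[of w v] field_simps power2_eq_square)

lemma foot_le_dist:
  assumes "v \<noteq> w"
  shows "foot p v w \<le> dist p v"
proof -
  have "\<bar>dist p v - dist v w\<bar> \<le> \<bar>dist p w\<bar>" by metric
  then have "(dist p v - dist v w)\<^sup>2 \<le> (dist p w)\<^sup>2" by (simp flip: abs_le_square_iff)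
  then show ?thesis using assms by (simp add: foot_def field_simps power2_eq_square)
qed

lemma dist_geodesic_le_foot:
  fixes p v w :: "'a::metric_space"
  assumes cat: "CAT0 TYPE('a)" and c: "geodesic c v w" and "v \<noteq> w" and s: "0 \<le> s" "s \<le> dist v w"
  shows "(dist p (c s))\<^sup>2 \<le> (dist p v)\<^sup>2 + s\<^sup>2 - 2 * s * foot p v w"
proof -
  have "2 * dist v w * foot p v w = (dist p v)\<^sup>2 + (dist v w)\<^sup>2 - (dist p w)\<^sup>2"
    using \<open>v \<noteq> w\<close> by (simp add: foot_def)
  then have "s * (2 * dist v w * foot p v w) = s * ((dist p v)\<^sup>2 + (dist v w)\<^sup>2 - (dist p w)\<^sup>2)"
    by simp
  then have "dist v w * (dist p (c s))\<^sup>2 \<le> dist v w * ((dist p v)\<^sup>2 + s\<^sup>2 - 2 * s * foot p v w)"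
    using CAT0_stewart[OF cat c s, of p]
    by (simp add: algebra_simps power2_eq_square)
  then show ?thesis using \<open>v \<noteq> w\<close> by simp
qed

text \<open>In the Euclidean plane, \<open>foot p v u + foot p v w\<close> is the inner product of \<open>p - v\<close> with the sum of
  the unit vectors from \<open>v\<close> towards \<open>u\<close> and \<open>w\<close>, and that sum has norm \<open>2 cos (\<theta> / 2)\<close>, where \<open>\<theta>\<close> is the
  angle between them. The midpoint \<open>m\<close> in the proof takes the place of that sum, scaled by \<open>s / 2\<close>.
  The distance from \<open>p\<close> to \<open>m\<close> is estimated from below by the triangle inequality and from above by
  convexity; the terms of second order in \<open>s\<close> cancel, so the estimate holds for small \<open>s\<close>
  without passing to the limit.\<close>

lemma CAT0_feet_le_turning:
  fixes p v u w :: "'a::metric_space"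
  assumes cat: "CAT0 TYPE('a)" and c: "geodesic c v u" and e: "geodesic e v w"
    and ne: "v \<noteq> u" "v \<noteq> w"
  shows "foot p v u + foot p v w \<le> dist p v * (pi - angle c e)" "angle c e \<le> pi"
proof -
  define D where "D = dist p v"
  define s where "s = (if D = 0 then min (dist v u) (dist v w) else min D (min (dist v u) (dist v w)))"
  define x y where "x = c s" and "y = e s"
  define \<theta> where "\<theta> = model_angle v x y"
  have D: "D \<ge> 0" by (simp add: D_def)
  have s: "0 < s" "s \<le> dist v u" "s \<le> dist v w" "D \<noteq> 0 \<Longrightarrow> s \<le> D"
    using ne D by (auto simp: s_def)
  have d: "dist v x = s" "dist v y = s"
    using dist_geodesic_start[OF c] dist_geodesic_start[OF e] s by (auto simp: x_def y_def)
  have nv: "x \<noteq> v" "y \<noteq> v" using d s by auto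
  have ang: "0 \<le> angle c e" "angle c e \<le> \<theta>"
    using CAT0_angle_le_model_angle[OF cat c e s(1,2) s(1,3)] by (auto simp: \<theta>_def x_def y_def)
  have \<theta>: "0 \<le> \<theta>" "\<theta> \<le> pi" using model_angle_bounds[OF nv] by (auto simp: \<theta>_def)
  then show "angle c e \<le> pi" using ang by simp
  show "foot p v u + foot p v w \<le> dist p v * (pi - angle c e)"
  proof (cases "D = 0")
    case True
    then have "p = v" by (simp add: D_def)
    then show ?thesis by (simp add: foot_def)
  next
    case False
    have cos\<theta>: "cos \<theta> = (2 * s\<^sup>2 - (dist x y)\<^sup>2) / (2 * s\<^sup>2)"
      using cos_arccos_abs[OF model_cos_bounds[OF nv]] d
      by (simp add: \<theta>_def model_angle_def power2_eq_square mult.assoc)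
    \<comment> \<open>the height over the base \<open>x y\<close> of the isosceles model triangle of \<open>v, x, y\<close>\<close>
    define q where "q = s * cos (\<theta> / 2)"
    have cpos: "0 \<le> cos (\<theta> / 2)" using \<theta> by (intro cos_ge_zero) auto
    have q: "0 \<le> q" "q \<le> D"
      using s(1) s(4)[OF False] cpos mult_left_mono[OF cos_le_one[of "\<theta> / 2"], of s]
      unfolding q_def by (simp, linarith)
    have "2 * (cos (\<theta> / 2))\<^sup>2 = 1 + cos \<theta>"
      using cos_double_cos[of "\<theta> / 2"] by simp
    then have q2: "q\<^sup>2 = s\<^sup>2 - (dist x y)\<^sup>2 / 4"
      using s by (simp add: q_def power_mult_distrib cos\<theta> field_simps)
    obtain m where m:
      "\<And>p. (dist p m)\<^sup>2 \<le> ((dist p x)\<^sup>2 + (dist p y)\<^sup>2) / 2 - (dist x y)\<^sup>2 / 4"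
      using CAT0_midpoint[OF cat, of x y] by blast
    have "(dist v m)\<^sup>2 \<le> q\<^sup>2" using m[of v] by (simp add: d q2)
    then have "dist v m \<le> q" using q by (rule_tac power2_le_imp_le)
    then have "D - q \<le> dist p m" unfolding D_def by metric
    then have "(D - q)\<^sup>2 \<le> (dist p m)\<^sup>2" using q by (intro power_mono) auto
    also have "\<dots> \<le> D\<^sup>2 + q\<^sup>2 - s * (foot p v u + foot p v w)"
      using m[of p] dist_geodesic_le_foot[OF cat c ne(1), of s p]
        dist_geodesic_le_foot[OF cat e ne(2), of s p] s
      by (simp add: D_def q2 x_def y_def algebra_simps)
    finally have "s * (foot p v u + foot p v w) \<le> s * (2 * D * cos (\<theta> / 2))"
      by (simp add: q_def power2_eq_square algebra_simps)
    then have "foot p v u + foot p v w \<le> 2 * D * cos (\<theta> / 2)"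
      using s by simp
    also have "\<dots> \<le> 2 * D * cos (angle c e / 2)"
      using ang \<theta> D by (intro mult_left_mono cos_monotone_0_pi_le) auto
    also have "cos (angle c e / 2) = sin ((pi - angle c e) / 2)"
      by (simp add: diff_divide_distrib sin_diff)
    also have "2 * D * sin ((pi - angle c e) / 2) \<le> 2 * D * ((pi - angle c e) / 2)"
      using ang \<theta> D by (intro mult_left_mono sin_x_le_x) auto
    finally show ?thesis by (simp add: D_def)
  qed
qed

definition polygon_length :: "'a::metric_space list \<Rightarrow> real" where
  "polygon_length vs = (\<Sum>i<length vs - 1. dist (vs ! i) (vs ! Suc i))"

text \<open>Each segment is the sum of the two pieces cut off by the foot of the altitude from \<open>p\<close>. At an
  interior vertex the pieces of the two adjacent segments add up to at most \<open>r\<close> times the rotation;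
  one piece is left over at either end.\<close>

lemma polygon_length_le:
  fixes p :: "'a::metric_space"
  assumes cat: "CAT0 TYPE('a)" and poly: "polygonal vs g" and ball: "set vs \<subseteq> cball p r"
  shows "polygon_length vs \<le> r * total_rotation vs g + dist p (hd vs) + dist p (last vs)"
proof (cases "length vs - 1")
  case 0
  then show ?thesis by (simp add: polygon_length_def total_rotation_def)
next
  case (Suc m)
  then have len: "length vs = Suc (Suc m)" by simp
  have ne: "vs ! i \<noteq> vs ! Suc i" and geo: "geodesic (g i) (vs ! i) (vs ! Suc i)"
    if "i < Suc m" for i
    using poly that len by (auto simp: polygonal_def)
  define turn where
    "turn i = pi - angle (\<lambda>s. g i (dist (vs ! i) (vs ! Suc i) - s)) (g (Suc i))" for i
  have "{0<..<Suc m} = Suc ` {..<m}" by (auto simp: image_iff gr0_conv_Suc)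
  then have rot: "total_rotation vs g = (\<Sum>i<m. turn i)"
    by (simp add: total_rotation_def turn_def len sum.reindex)
  have vertex: "foot p (vs ! Suc i) (vs ! Suc (Suc i)) + foot p (vs ! Suc i) (vs ! i) \<le> r * turn i"
    if "i < m" for i
  proof -
    let ?c = "\<lambda>s. g i (dist (vs ! i) (vs ! Suc i) - s)"
    have c: "geodesic ?c (vs ! Suc i) (vs ! i)"
      using geodesic_reverse[OF geo] that by simp
    have e: "geodesic (g (Suc i)) (vs ! Suc i) (vs ! Suc (Suc i))" using geo that by simp
    have n: "vs ! Suc i \<noteq> vs ! i" "vs ! Suc i \<noteq> vs ! Suc (Suc i)"
      using ne[of i] ne[of "Suc i"] that by auto
    have "dist p (vs ! Suc i) \<le> r" using ball that len by (auto simp: subset_iff)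
    then have "dist p (vs ! Suc i) * turn i \<le> r * turn i"
      using CAT0_feet_le_turning(2)[OF cat c e n] by (intro mult_right_mono) (auto simp: turn_def)
    then show ?thesis
      using CAT0_feet_le_turning(1)[OF cat c e n, of p] by (simp add: turn_def)
  qed
  have "polygon_length vs
      = (\<Sum>i<Suc m. foot p (vs ! i) (vs ! Suc i)) + (\<Sum>i<Suc m. foot p (vs ! Suc i) (vs ! i))"
    unfolding polygon_length_def Suc sum.distrib[symmetric]
    by (intro sum.cong) (auto simp: foot_add_foot[OF ne])
  also have "(\<Sum>i<Suc m. foot p (vs ! i) (vs ! Suc i))
      = foot p (vs ! 0) (vs ! 1) + (\<Sum>i<m. foot p (vs ! Suc i) (vs ! Suc (Suc i)))"
    by (simp add: sum.lessThan_Suc_shift del: sum.lessThan_Suc)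
  also have "(\<Sum>i<Suc m. foot p (vs ! Suc i) (vs ! i))
      = (\<Sum>i<m. foot p (vs ! Suc i) (vs ! i)) + foot p (vs ! Suc m) (vs ! m)"
    by simp
  also have "foot p (vs ! 0) (vs ! 1) \<le> dist p (hd vs)"
    using foot_le_dist[OF ne[of 0], of p] hd_conv_nth[of vs] len by force
  also have "foot p (vs ! Suc m) (vs ! m) \<le> dist p (last vs)"
    using foot_le_dist[OF ne[of m, symmetric], of p] last_conv_nth[of vs] len by force
  finally show ?thesis
    using sum_mono[of "{..<m}" _ "\<lambda>i. r * turn i", OF vertex]
    by (simp add: rot sum.distrib sum_distrib_left)
qed

section \<open>Inscribed polygons\<close>

lemma polygon_length_simps [simp]:
  "polygon_length [] = 0" "polygon_length [x] = 0"
  "polygon_length (x # y # zs) = dist x y + polygon_length (y # zs)"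
  by (simp_all add: polygon_length_def sum.lessThan_Suc_shift del: sum.lessThan_Suc)

lemma polygon_length_append:
  "polygon_length (xs @ y # zs) = polygon_length (xs @ [y]) + polygon_length (y # zs)"
proof (induction xs)
  case (Cons x xs)
  then show ?case by (cases xs) auto
qed simp

lemma mesh_less_iff:
  assumes "0 < \<delta>"
  shows "mesh vs < \<delta> \<longleftrightarrow> successively (\<lambda>x y. dist x y < \<delta>) vs"
proof -
  have "{dist (vs ! i) (vs ! Suc i) | i. Suc i < length vs}
      = (\<lambda>i. dist (vs ! i) (vs ! Suc i)) ` {i. Suc i < length vs}" by auto
  moreover have "finite {i. Suc i < length vs}"
    by (rule finite_subset[of _ "{..length vs}"]) auto
  ultimately show ?thesis
    using assms unfolding mesh_def successively_conv_nth by (subst Max_less_iff) auto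
qed

lemma arclength_dist_le:
  assumes "arclength_parametrized \<gamma>" "0 \<le> a" "a \<le> b"
  shows "dist (\<gamma> a) (\<gamma> b) \<le> b - a"
proof (cases "a = b")
  case False
  then have "[a, b] \<in> partitions a b" using assms by (simp add: partitions_def)
  then have "ennreal (dist (\<gamma> a) (\<gamma> b)) \<le> curve_length \<gamma> a b"
    unfolding curve_length_def by (rule SUP_upper2) simp
  then show ?thesis using assms by (simp add: arclength_parametrized_def)
qed simp

lemma partitions_subset:
  assumes "ts \<in> partitions a b"
  shows "set ts \<subseteq> {a..b}"
proof -
  have ts: "ts \<noteq> []" "sorted_wrt (<) ts" "hd ts = a" "last ts = b"
    using assms by (auto simp: partitions_def)
  have "a \<le> x" if "x \<in> set ts" for x
    using ts that by (cases ts) auto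
  moreover have "x \<le> b" if "x \<in> set ts" for x
    using ts that by (cases ts rule: rev_cases) (auto simp: sorted_wrt_append)
  ultimately show ?thesis by auto
qed

lemma partitions_join:
  assumes "ts \<in> partitions a m" "us \<in> partitions m b"
  obtains xs zs where "ts = xs @ [m]" "us = m # zs" "xs @ m # zs \<in> partitions a b"
proof -
  obtain xs where xs: "ts = xs @ [m]"
    using assms(1) by (cases ts rule: rev_cases) (auto simp: partitions_def)
  obtain zs where zs: "us = m # zs"
    using assms(2) by (cases us) (auto simp: partitions_def)
  have "xs @ m # zs \<in> partitions a b"
    using assms unfolding xs zs partitions_def
    by (auto simp: sorted_wrt_append hd_append split: if_splits intro: less_trans)
  then show thesis using that xs zs by blast
qed

text \<open>An arc of length less than \<open>\<delta>\<close> has diameter less than \<open>\<delta>\<close>, so that any partition of it is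
  \<open>\<delta>\<close>-fine.\<close>

lemma short_arc_partition:
  assumes arc: "arclength_parametrized \<gamma>" and ab: "0 \<le> a" "a < b" "b - a < \<delta>" and q: "q < 1"
  shows "\<exists>ts\<in>partitions a b. successively (\<lambda>x y. dist x y < \<delta>) (map \<gamma> ts)
           \<and> q * (b - a) \<le> polygon_length (map \<gamma> ts)"
proof -
  have "q * (b - a) < b - a" using ab q by simp
  then have "ennreal (q * (b - a)) < curve_length \<gamma> a b"
    using arc ab by (simp add: arclength_parametrized_def ennreal_lessI)
  then obtain ts where ts: "ts \<in> partitions a b"
    "ennreal (q * (b - a)) < (\<Sum>i<length ts - 1. ennreal (dist (\<gamma> (ts ! i)) (\<gamma> (ts ! Suc i))))"
    unfolding curve_length_def less_SUP_iff by blast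
  have "(\<Sum>i<length ts - 1. ennreal (dist (\<gamma> (ts ! i)) (\<gamma> (ts ! Suc i))))
      = ennreal (polygon_length (map \<gamma> ts))"
    by (simp add: polygon_length_def)
  then have "ennreal (q * (b - a)) \<le> ennreal (polygon_length (map \<gamma> ts))"
    using ts(2) by simp
  moreover have "0 \<le> polygon_length (map \<gamma> ts)" by (simp add: polygon_length_def sum_nonneg)
  ultimately have "q * (b - a) \<le> polygon_length (map \<gamma> ts)" by simp
  moreover have "successively (\<lambda>x y. dist x y < \<delta>) (map \<gamma> ts)"
    unfolding successively_conv_nth
  proof (intro allI impI)
    fix i assume i: "Suc i < length (map \<gamma> ts)"
    then have lt: "ts ! i < ts ! Suc i"
      using ts(1) by (auto simp: partitions_def sorted_wrt_nth_less)
    have "ts ! i \<in> {a..b}" "ts ! Suc i \<in> {a..b}"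
      using subsetD[OF partitions_subset[OF ts(1)], OF nth_mem] i by (simp_all del: atLeastAtMost_iff)
    then have "dist (\<gamma> (ts ! i)) (\<gamma> (ts ! Suc i)) < \<delta>"
      using arclength_dist_le[OF arc, of "ts ! i" "ts ! Suc i"] lt ab by auto
    then show "dist (map \<gamma> ts ! i) (map \<gamma> ts ! Suc i) < \<delta>" using i by simp
  qed
  ultimately show ?thesis using ts(1) by blast
qed

text \<open>Halving the interval until the pieces are short, and joining the partitions of the pieces, yields
  small mesh and large length at once.\<close>

lemma fine_partition:
  assumes arc: "arclength_parametrized \<gamma>" and "0 \<le> a" "a < b" "b - a < 2 ^ n * \<delta>" "q < 1"
  shows "\<exists>ts\<in>partitions a b. successively (\<lambda>x y. dist x y < \<delta>) (map \<gamma> ts)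
           \<and> q * (b - a) \<le> polygon_length (map \<gamma> ts)"
  using assms(2-)
proof (induction n arbitrary: a b)
  case 0
  then show ?case using short_arc_partition[OF arc] by simp
next
  case (Suc n)
  define m where "m = (a + b) / 2"
  have "\<exists>ts\<in>partitions a m. successively (\<lambda>x y. dist x y < \<delta>) (map \<gamma> ts)
      \<and> q * (m - a) \<le> polygon_length (map \<gamma> ts)"
    using Suc.prems by (intro Suc.IH) (auto simp: m_def field_simps)
  then obtain ts where ts: "ts \<in> partitions a m" "successively (\<lambda>x y. dist x y < \<delta>) (map \<gamma> ts)"
    "q * (m - a) \<le> polygon_length (map \<gamma> ts)" by blast
  have "\<exists>us\<in>partitions m b. successively (\<lambda>x y. dist x y < \<delta>) (map \<gamma> us)
      \<and> q * (b - m) \<le> polygon_length (map \<gamma> us)"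
    using Suc.prems by (intro Suc.IH) (auto simp: m_def field_simps)
  then obtain us where us: "us \<in> partitions m b" "successively (\<lambda>x y. dist x y < \<delta>) (map \<gamma> us)"
    "q * (b - m) \<le> polygon_length (map \<gamma> us)" by blast
  obtain xs zs where j: "ts = xs @ [m]" "us = m # zs" "xs @ m # zs \<in> partitions a b"
    using partitions_join[OF ts(1) us(1)] .
  have "successively (\<lambda>x y. dist x y < \<delta>) (map \<gamma> (xs @ m # zs))"
    using ts(2) us(2) unfolding j by (auto simp: successively_append_iff)
  moreover have "q * (b - a) \<le> polygon_length (map \<gamma> (xs @ m # zs))"
    using ts(3) us(3) polygon_length_append[of "map \<gamma> xs" "\<gamma> m" "map \<gamma> zs"] unfolding j
    by (simp add: algebra_simps)
  ultimately show ?case using j(3) by blast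
qed

text \<open>A polygonal curve must not have degenerate segments. When \<open>\<gamma>\<close> takes the same value at two
  consecutive points of a partition, one of them can be dropped without changing the length or the
  remaining segments. It has to be one that is not an endpoint of the interval; if both were
  endpoints, the polygon would have length \<open>0\<close>.\<close>

lemma partition_without_repetition:
  assumes ts: "ts \<in> partitions a b" "successively P (map \<gamma> ts)" "L \<le> polygon_length (map \<gamma> ts)"
    and L: "0 < L"
  shows "\<exists>us\<in>partitions a b. successively P (map \<gamma> us) \<and> L \<le> polygon_length (map \<gamma> us)
           \<and> successively (\<noteq>) (map \<gamma> us)"
  using ts
proof (induction ts rule: length_induct)
  case (1 ts)
  show ?case
  proof (cases "successively (\<noteq>) (map \<gamma> ts)")
    case True
    then show ?thesis using "1.prems" by blast
  next
    case False
    then obtain i where i: "Suc i < length ts" "\<gamma> (ts ! i) = \<gamma> (ts ! Suc i)"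
      by (auto simp: successively_conv_nth)
    define xs x y zs where "xs = take i ts" and "x = ts ! i" and "y = ts ! Suc i"
      and "zs = drop (Suc (Suc i)) ts"
    have eq: "ts = xs @ x # y # zs" and xy: "\<gamma> x = \<gamma> y"
      using i by (simp_all add: xs_def x_def y_def zs_def Cons_nth_drop_Suc id_take_nth_drop[symmetric])
    have len: "polygon_length (map \<gamma> ts) = polygon_length (map \<gamma> (xs @ y # zs))"
      using polygon_length_append[of "map \<gamma> xs" "\<gamma> y" "\<gamma> y # map \<gamma> zs"]
        polygon_length_append[of "map \<gamma> xs" "\<gamma> y" "map \<gamma> zs"]
      unfolding eq xy list.map map_append polygon_length_simps dist_self by linarith
    have suc: "successively P (map \<gamma> (xs @ y # zs))"
      using "1.prems"(2) by (auto simp: eq xy successively_append_iff)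
    obtain us where "us \<in> partitions a b" "map \<gamma> us = map \<gamma> (xs @ y # zs)" "length us < length ts"
    proof (cases "xs = []")
      case False
      then have "xs @ y # zs \<in> partitions a b"
        using "1.prems"(1) by (auto simp: eq partitions_def sorted_wrt_append)
      then show thesis using that by (simp add: eq)
    next
      case True
      have "zs \<noteq> []" using len "1.prems"(3) L True by auto
      then have "x # zs \<in> partitions a b"
        using "1.prems"(1) True by (auto simp: eq partitions_def)
      then show thesis using that True xy by (simp add: eq)
    qed
    then show ?thesis using "1.IH" suc len "1.prems"(3) by metis
  qed
qed

lemma inscribed_polygon_exists:
  fixes \<gamma> :: "real \<Rightarrow> 'a::metric_space"
  assumes cat: "CAT0 TYPE('a)" and arc: "arclength_parametrized \<gamma>"
    and "0 < t" "0 < \<delta>" "0 < q" "q < 1"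
  obtains vs g where "(vs, g) \<in> inscribed \<gamma> 0 t" "mesh vs < \<delta>" "q * t \<le> polygon_length vs"
    "hd vs = \<gamma> 0" "last vs = \<gamma> t" "set vs \<subseteq> \<gamma> ` {0..t}"
proof -
  obtain n where "t / \<delta> < 2 ^ n" using real_arch_pow[of 2 "t / \<delta>"] by auto
  then have "t - 0 < 2 ^ n * \<delta>" using assms by (simp add: field_simps)
  then obtain ts where ts: "ts \<in> partitions 0 t" "successively (\<lambda>x y. dist x y < \<delta>) (map \<gamma> ts)"
    "q * t \<le> polygon_length (map \<gamma> ts)"
    using fine_partition[OF arc, of 0 t n \<delta> q] assms by auto
  obtain us where us: "us \<in> partitions 0 t" "successively (\<lambda>x y. dist x y < \<delta>) (map \<gamma> us)"
    "q * t \<le> polygon_length (map \<gamma> us)" "successively (\<noteq>) (map \<gamma> us)"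
    using partition_without_repetition[OF ts] assms by auto
  have "\<exists>c. geodesic c (\<gamma> (us ! i)) (\<gamma> (us ! Suc i))" for i
    using CAT0_geodesic_exists[OF cat] by metis
  then obtain g where "\<And>i. geodesic (g i) (\<gamma> (us ! i)) (\<gamma> (us ! Suc i))" by metis
  then have "polygonal (map \<gamma> us) g"
    using us(1,4) by (auto simp: polygonal_def partitions_def successively_conv_nth)
  then have "(map \<gamma> us, g) \<in> inscribed \<gamma> 0 t" using us(1) by (auto simp: inscribed_def)
  then show thesis
    using us partitions_subset[OF us(1)] mesh_less_iff[OF \<open>0 < \<delta>\<close>]
    by (intro that[of "map \<gamma> us" g]) (auto simp: partitions_def hd_map last_map)
qed

section \<open>Length, circumradius and total curvature\<close>

text \<open>For a polygon inscribed in \<open>\<gamma>\<close> with apex \<open>\<gamma> 0\<close>, the boundary terms are \<open>0\<close> at the start and at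
  most \<open>r\<close> at the end, which accounts for the summand \<open>1\<close>.\<close>

lemma arclength_le_radius_times_curvature:
  fixes \<gamma> :: "real \<Rightarrow> 'a::metric_space"
  assumes cat: "CAT0 TYPE('a)" and arc: "arclength_parametrized \<gamma>" and t: "0 < t"
    and ball: "\<gamma> ` {0..t} \<subseteq> cball (\<gamma> 0) r"
    and K: "0 \<le> K" "total_curvature \<gamma> 0 t \<le> ennreal K"
  shows "t \<le> r * (K + 1)"
proof -
  have r: "0 \<le> r" using ball t by force
  have main: "q * t \<le> r * (K + 1 + \<epsilon>)" if q: "0 < q" "q < 1" and \<epsilon>: "0 < \<epsilon>" for q \<epsilon>
  proof -
    have "total_curvature \<gamma> 0 t < ennreal (K + \<epsilon>)"
      using K \<epsilon> by (auto intro: le_less_trans simp: ennreal_lessI)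
    then obtain \<delta> where \<delta>: "0 < \<delta>"
      "(SUP (vs, g)\<in>{(vs, g) \<in> inscribed \<gamma> 0 t. mesh vs < \<delta>}. ennreal (total_rotation vs g))
         < ennreal (K + \<epsilon>)"
      unfolding total_curvature_def INF_less_iff by auto
    obtain vs g where vs: "(vs, g) \<in> inscribed \<gamma> 0 t" "mesh vs < \<delta>" "q * t \<le> polygon_length vs"
      "hd vs = \<gamma> 0" "last vs = \<gamma> t" "set vs \<subseteq> \<gamma> ` {0..t}"
      using inscribed_polygon_exists[OF cat arc t \<delta>(1) q] .
    have "ennreal (total_rotation vs g) < ennreal (K + \<epsilon>)"
      by (rule le_less_trans[OF _ \<delta>(2)]) (use vs in \<open>auto intro!: SUP_upper2[of "(vs, g)"]\<close>)
    then have rot: "total_rotation vs g \<le> K + \<epsilon>"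
      using K \<epsilon> by (metis add_nonneg_nonneg ennreal_le_iff less_imp_le)
    have "polygon_length vs \<le> r * total_rotation vs g + dist (\<gamma> 0) (hd vs) + dist (\<gamma> 0) (last vs)"
      using vs(1,6) ball by (intro polygon_length_le[OF cat]) (auto simp: inscribed_def)
    also have "\<dots> \<le> r * (K + \<epsilon>) + 0 + r"
      using vs(4,5) ball t by (intro add_mono mult_left_mono rot r) (auto simp: image_subset_iff)
    finally show ?thesis using vs(3) by (simp add: algebra_simps)
  qed
  have "((\<lambda>\<epsilon>. (1 - \<epsilon>) * t) \<longlongrightarrow> (1 - 0) * t) (at_right 0)"
    by (intro tendsto_intros)
  moreover have "((\<lambda>\<epsilon>. r * (K + 1 + \<epsilon>)) \<longlongrightarrow> r * (K + 1 + 0)) (at_right 0)"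
    by (intro tendsto_intros)
  moreover have "eventually (\<lambda>\<epsilon>. (1 - \<epsilon>) * t \<le> r * (K + 1 + \<epsilon>)) (at_right 0)"
    by (rule eventually_at_rightI[of 0 1]) (auto intro: main)
  ultimately have "(1 - 0) * t \<le> r * (K + 1 + 0)"
    by (intro tendsto_le[of "at_right 0"]) auto
  then show ?thesis by simp
qed

text \<open>A least radius exists because \<open>\<gamma>\<close> attains its maximal distance from \<open>\<gamma> 0\<close> on the compact
  interval.\<close>

lemma circumradius_ball:
  assumes arc: "arclength_parametrized \<gamma>" and t: "0 \<le> t"
  shows "\<gamma> ` {0..t} \<subseteq> cball (\<gamma> 0) (circumradius \<gamma> t)"
proof -
  have "continuous_on {0..t} (\<lambda>s. dist (\<gamma> 0) (\<gamma> s))"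
    using arc unfolding arclength_parametrized_def
    by (intro continuous_intros) (auto elim: continuous_on_subset)
  then obtain s where s: "s \<in> {0..t}" "\<And>u. u \<in> {0..t} \<Longrightarrow> dist (\<gamma> 0) (\<gamma> u) \<le> dist (\<gamma> 0) (\<gamma> s)"
    using continuous_attains_sup[of "{0..t}" "\<lambda>s. dist (\<gamma> 0) (\<gamma> s)"] t by fastforce
  have "circumradius \<gamma> t = dist (\<gamma> 0) (\<gamma> s)"
    unfolding circumradius_def using s by (intro Least_equality) (auto simp: image_subset_iff)
  then show ?thesis using s by auto
qed

lemma unbounded_if_sublinear_curvature:
  fixes \<gamma> :: "real \<Rightarrow> 'a::metric_space"
  assumes cat: "CAT0 TYPE('a)" and arc: "arclength_parametrized \<gamma>"
    and lim: "Liminf at_top (\<lambda>t. total_curvature \<gamma> 0 t / ennreal t) = 0"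
  shows "\<not> bounded (\<gamma> ` {0..})"
proof
  assume "bounded (\<gamma> ` {0..})"
  then obtain r where "0 < r" and r: "\<gamma> ` {0..} \<subseteq> cball (\<gamma> 0) r"
    using bounded_subset_ballD[of "\<gamma> ` {0..}" "\<gamma> 0"] ball_subset_cball by blast
  have "ennreal (1 / (2 * r)) \<le> total_curvature \<gamma> 0 t / ennreal t" if "2 * r < t" for t
  proof (rule ccontr)
    assume "\<not> ?thesis"
    then have "total_curvature \<gamma> 0 t / ennreal t \<le> ennreal (1 / (2 * r))" by simp
    then have "total_curvature \<gamma> 0 t / ennreal t * ennreal t \<le> ennreal (1 / (2 * r)) * ennreal t"
      by (rule mult_right_mono) simp
    also have "total_curvature \<gamma> 0 t / ennreal t * ennreal t = total_curvature \<gamma> 0 t"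
      using that \<open>0 < r\<close>
      by (simp add: ennreal_divide_times ennreal_mult_divide_eq ennreal_zero_neq_top)
    finally have "total_curvature \<gamma> 0 t \<le> ennreal (1 / (2 * r)) * ennreal t" .
    also have "\<dots> = ennreal (t / (2 * r))"
      using that \<open>0 < r\<close> by (simp flip: ennreal_mult)
    finally have "t \<le> r * (t / (2 * r) + 1)"
      using that \<open>0 < r\<close> r
      by (intro arclength_le_radius_times_curvature[OF cat arc]) (auto simp: image_subset_iff)
    then show False using that \<open>0 < r\<close> by (simp add: field_simps)
  qed
  then have "eventually (\<lambda>t. ennreal (1 / (2 * r)) \<le> total_curvature \<gamma> 0 t / ennreal t) at_top"
    using eventually_gt_at_top[of "2 * r"] by (rule_tac eventually_mono)
  then have "ennreal (1 / (2 * r)) \<le> 0"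
    using Liminf_bounded lim by metis
  then show False using \<open>0 < r\<close> by (simp add: ennreal_eq_0_iff)
qed

lemma circumradius_lower_bound:
  fixes \<gamma> :: "real \<Rightarrow> 'a::metric_space"
  assumes cat: "CAT0 TYPE('a)" and arc: "arclength_parametrized \<gamma>" and a: "0 \<le> a" and C: "0 < C"
    and bnd: "eventually (\<lambda>t. total_curvature \<gamma> 0 t \<le> ennreal (C * t powr a)) at_top"
  shows "circumradius \<gamma> \<in> \<Omega>[at_top](\<lambda>t. t powr (1 - a))"
proof (rule landau_omega.bigI[of "1 / (C + 1)"])
  show "eventually (\<lambda>t. norm (circumradius \<gamma> t) \<ge> 1 / (C + 1) * norm (t powr (1 - a))) at_top"
    using bnd eventually_ge_at_top[of 1]
  proof eventually_elim
    case (elim t)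
    let ?c = "circumradius \<gamma> t"
    have ball: "\<gamma> ` {0..t} \<subseteq> cball (\<gamma> 0) ?c"
      using circumradius_ball[OF arc] elim by simp
    have c: "0 \<le> ?c" using ball elim(2) by force
    have "t \<le> ?c * (C * t powr a + 1)"
      using elim C by (intro arclength_le_radius_times_curvature[OF cat arc _ ball]) auto
    also have "\<dots> \<le> ?c * ((C + 1) * t powr a)"
      using c ge_one_powr_ge_zero[OF elim(2) a] by (intro mult_left_mono) (auto simp: algebra_simps)
    finally have "t powr (1 - a) \<le> ?c * (C + 1)"
      using elim(2) by (simp add: powr_diff field_simps)
    then show ?case using c C by (simp add: field_simps)
  qed
qed (use C in simp)

theorem theorem4:
  fixes \<gamma> :: "real \<Rightarrow> 'a::metric_space"
  assumes "CAT0 TYPE('a)"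
    and "arclength_parametrized \<gamma>"
  shows "(Liminf at_top (\<lambda>t. total_curvature \<gamma> 0 t / ennreal t) = 0 \<longrightarrow>
            \<not> bounded (\<gamma> ` {0..})) \<and>
         (\<forall>a\<in>{0<..<1}.
            (\<exists>C>0. eventually (\<lambda>t. total_curvature \<gamma> 0 t \<le> ennreal (C * t powr a)) at_top) \<longrightarrow>
            circumradius \<gamma> \<in> \<Omega>[at_top](\<lambda>t. t powr (1 - a)))"
  using unbounded_if_sublinear_curvature[OF assms] circumradius_lower_bound[OF assms] by auto

end
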